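(* Let $R$ be a finite commutative von Neumann regular ring. The graph $\Gamma'_{Reg}(R)$ has a pendant vertex if and only if either $R\cong F_1$ for some field $F_1$ with $|F_1|\geq 4$, or $R\cong\mathbb{F}_2\times F$ for some field $F$.
   Context: All rings have an identity. A ring $R$ is von Neumann regular if for every $x\in R$ there is $y\in R$ with $xyx=x$. For such $R$, $\Gamma'_{Reg}(R)$ is the simple graph with vertex set $R\setminus\{0_R\}$ in which two distinct vertices $a,b$ are adjacent if and only if $aba=a$ or $bab=b$. A pendant vertex is a vertex of degree $1$. $\mathbb{F}_q$ denotes the field with $q$ elements. *)

theory Defs
  imports
    "HOL-Algebra.Algebra"
    "HOL-Number_Theory.Residues"
    "Graph_Theory.Pair_Digraph"
begin

locale von_neumann_regular_ring = ring +
  assumes von_neumann_regular: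
    "x \<in> carrier R \<Longrightarrow> \<exists>y\<in>carrier R. x \<otimes> y \<otimes> x = x"

(* A simple graph is represented, as throughout Graph_Theory, by a loop-free digraph
   whose arc relation is symmetric, so that every edge {a, b} gives the two arcs
   (a, b) and (b, a). *)
definition reg_graph :: "('a, 'm) ring_scheme \<Rightarrow> 'a pair_pre_digraph"
  where "reg_graph R =
    \<lparr> pverts = carrier R - {\<zero>\<^bsub>R\<^esub>},
      parcs = {(a, b). a \<in> carrier R - {\<zero>\<^bsub>R\<^esub>} \<and> b \<in> carrier R - {\<zero>\<^bsub>R\<^esub>} \<and> a \<noteq> b \<and>
        (a \<otimes>\<^bsub>R\<^esub> b \<otimes>\<^bsub>R\<^esub> a = a \<or> b \<otimes>\<^bsub>R\<^esub> a \<otimes>\<^bsub>R\<^esub> b = b)} \<rparr>"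

lemma pair_graph_reg_graph:
  assumes "finite (carrier R)"
  shows "pair_graph (reg_graph R)"
proof unfold_locales
  have "parcs (reg_graph R) \<subseteq> carrier R \<times> carrier R"
    by (auto simp: reg_graph_def)
  with assms show "finite (parcs (reg_graph R))"
    by (simp add: finite_subset)
  show "symmetric (with_proj (reg_graph R))"
    by (auto simp: symmetric_def sym_def arcs_ends_conv reg_graph_def)
qed (use assms in \<open>auto simp: reg_graph_def\<close>)

(* In a symmetric digraph the degree of a vertex is its out-degree. *)
definition pendant_vertex :: "('a, 'b) pre_digraph \<Rightarrow> 'a \<Rightarrow> bool"
  where "pendant_vertex G v \<longleftrightarrow> v \<in> verts G \<and> out_degree G v = 1"

(* HOL cannot quantify existentially over types.  The next two lemmas show that nothing is lost
   when the fields F in "R is isomorphic to F" and "R is isomorphic to K x F" range only over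
   fields on the element type of R. *)
lemma iso_field_same_type:
  fixes R :: "('a, 'm) ring_scheme" and F :: "('b, 'n) ring_scheme"
  assumes R: "ring R" and F: "field F" and iso: "R \<simeq> F"
  shows "\<exists>F' :: 'a ring. field F' \<and> R \<simeq> F' \<and> card (carrier F') = card (carrier F)"
proof -
  interpret F: field F by (rule F)
  from ring_iso_sym[OF R iso] obtain g where g: "g \<in> ring_iso F R"
    by (auto simp: is_ring_iso_def)
  then have inj: "inj_on g (carrier F)"
    by (auto simp: ring_iso_def bij_betw_def)
  have F': "F \<simeq> image_ring g F"
    using inj_imp_image_ring_iso[OF inj] by (auto simp: is_ring_iso_def)
  then show ?thesis
    using F.inj_imp_image_ring_is_field[OF inj] ring_iso_trans[OF iso F'] ring_iso_same_card[OF F']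
    by metis
qed

lemma iso_RDirProd_field_same_type:
  fixes R :: "('a, 'm) ring_scheme" and K :: "('c, 'k) ring_scheme" and F :: "('b, 'n) ring_scheme"
  assumes R: "ring R" and K: "ring K" and F: "field F" and iso: "R \<simeq> RDirProd K F"
  shows "\<exists>F' :: 'a ring. field F' \<and> R \<simeq> RDirProd K F'"
proof -
  interpret K: ring K by (rule K)
  interpret F: field F by (rule F)
  from ring_iso_sym[OF R iso] obtain g where g: "g \<in> ring_iso (RDirProd K F) R"
    by (auto simp: is_ring_iso_def)
  then have "inj_on g (carrier K \<times> carrier F)"
    by (auto simp: ring_iso_def bij_betw_def RDirProd_carrier)
  then have inj: "inj_on (\<lambda>x. g (\<zero>\<^bsub>K\<^esub>, x)) (carrier F)"
    by (auto simp: inj_on_def)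
  have "RDirProd K F \<simeq> RDirProd K (image_ring (\<lambda>x. g (\<zero>\<^bsub>K\<^esub>, x)) F)"
    using RDirProd_iso5[OF inj_imp_image_ring_iso[OF inj]] by (auto simp: is_ring_iso_def)
  then show ?thesis
    using F.inj_imp_image_ring_is_field[OF inj] ring_iso_trans[OF iso] by blast
qed

end

theory Submission
  imports Defs
begin

text \<open>
  Let \<open>a\<close> be a pendant vertex, \<open>a'\<close> a generalised inverse of \<open>a\<close> with \<open>a' a a' = a'\<close>,
  and \<open>e = a a'\<close>. For an idempotent \<open>f\<close> below \<open>e\<close> with \<open>f \<noteq> 0, e\<close>, both
  \<open>f a'\<close> and \<open>(e - f) a'\<close> would be neighbours of \<open>a\<close>; hence \<open>e\<close> is primitive and
  \<open>e R\<close> is a field. Every element of \<open>a' + (1 - e) R\<close> other than \<open>a\<close> is a neighbour of \<open>a\<close>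
  too, so \<open>(1 - e) R\<close> has at most two elements: either \<open>R = e R\<close>, or \<open>R\<close> is the
  product of the field with two elements and \<open>e R\<close>.
  Conversely, in a field the only possible neighbour of \<open>a\<close> is its inverse, and in the product
  the vertex \<open>(0, 1)\<close> has \<open>(1, 1)\<close> as its only neighbour.
\<close>

section \<open>Pendant vertices as unique neighbours, and their invariance under ring
  isomorphism\<close>

lemma pendant_vertex_reg_graph_iff:
  "pendant_vertex (with_proj (reg_graph R)) a \<longleftrightarrow>
    a \<in> carrier R - {\<zero>\<^bsub>R\<^esub>} \<and> (\<exists>!b. (a, b) \<in> parcs (reg_graph R))"
proof -
  have "out_arcs (with_proj (reg_graph R)) a = Pair a ` {b. (a, b) \<in> parcs (reg_graph R)}"
    by (auto simp: out_arcs_def)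
  then have "out_degree (with_proj (reg_graph R)) a = 1 \<longleftrightarrow> card {b. (a, b) \<in> parcs (reg_graph R)} = 1"
    by (simp add: out_degree_def card_image inj_on_def)
  also have "\<dots> \<longleftrightarrow> (\<exists>!b. (a, b) \<in> parcs (reg_graph R))"
    unfolding One_nat_def card_1_singleton_iff by (simp add: set_eq_iff) metis
  finally show ?thesis
    by (simp add: pendant_vertex_def) (simp add: reg_graph_def)
qed

text \<open>An isomorphism preserves and reflects arcs, since both defining equations are
  multiplicative. The theorem applies this to the inverse isomorphism, carrying a pendant vertex
  from a field or product back to \<open>R\<close>.\<close>

lemma ring_iso_pendant_vertex:
  assumes "ring R" "ring S" and iso: "R \<simeq> S"
    and pend: "\<exists>v. pendant_vertex (with_proj (reg_graph R)) v"
  shows "\<exists>v. pendant_vertex (with_proj (reg_graph S)) v"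
proof -
  interpret R: ring R by fact
  interpret S: ring S by fact
  obtain h where h: "h \<in> ring_iso R S"
    using iso by (auto simp: is_ring_iso_def)
  then have hom: "h \<in> ring_hom R S" and bij: "bij_betw h (carrier R) (carrier S)"
    by (auto simp: ring_iso_def)
  have inj: "h x = h y \<longleftrightarrow> x = y" if "x \<in> carrier R" "y \<in> carrier R" for x y
    using bij that by (auto simp: bij_betw_def inj_on_def)
  have z: "h \<zero>\<^bsub>R\<^esub> = \<zero>\<^bsub>S\<^esub>"
    using ring_hom_zero[OF hom] assms by blast
  have arc: "(h x, h y) \<in> parcs (reg_graph S) \<longleftrightarrow> (x, y) \<in> parcs (reg_graph R)"
    if "x \<in> carrier R" "y \<in> carrier R" for x y
  proof -
    have "h x \<otimes>\<^bsub>S\<^esub> h y \<otimes>\<^bsub>S\<^esub> h x = h x \<longleftrightarrow> x \<otimes>\<^bsub>R\<^esub> y \<otimes>\<^bsub>R\<^esub> x = x"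
      "h y \<otimes>\<^bsub>S\<^esub> h x \<otimes>\<^bsub>S\<^esub> h y = h y \<longleftrightarrow> y \<otimes>\<^bsub>R\<^esub> x \<otimes>\<^bsub>R\<^esub> y = y"
      using that by (simp_all add: inj flip: ring_hom_mult[OF hom])
    moreover have "h x = \<zero>\<^bsub>S\<^esub> \<longleftrightarrow> x = \<zero>\<^bsub>R\<^esub>" "h y = \<zero>\<^bsub>S\<^esub> \<longleftrightarrow> y = \<zero>\<^bsub>R\<^esub>"
      using that inj[of _ "\<zero>\<^bsub>R\<^esub>"] by (auto simp: z)
    ultimately show ?thesis
      using that by (simp add: reg_graph_def inj ring_hom_closed[OF hom])
  qed
  obtain v b where v: "v \<in> carrier R" "v \<noteq> \<zero>\<^bsub>R\<^esub>" and b: "(v, b) \<in> parcs (reg_graph R)"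
    and uniq: "\<And>c. (v, c) \<in> parcs (reg_graph R) \<Longrightarrow> c = b"
    using pend by (auto simp: pendant_vertex_reg_graph_iff)
  have bc: "b \<in> carrier R"
    using b by (simp add: reg_graph_def)
  have "c = h b" if c: "(h v, c) \<in> parcs (reg_graph S)" for c
  proof -
    have "c \<in> carrier S"
      using c by (simp add: reg_graph_def)
    then obtain d where "d \<in> carrier R" "c = h d"
      using bij by (auto simp: bij_betw_def)
    then show ?thesis
      using c arc v uniq by blast
  qed
  moreover have "(h v, h b) \<in> parcs (reg_graph S)"
    using arc v bc b by blast
  moreover have "h v \<in> carrier S - {\<zero>\<^bsub>S\<^esub>}"
    using v inj[of v "\<zero>\<^bsub>R\<^esub>"] ring_hom_closed[OF hom] by (auto simp: z)
  ultimately show ?thesis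
    by (auto simp: pendant_vertex_reg_graph_iff)
qed

section \<open>Idempotents, corner rings and the splitting off of the two-element field\<close>

context cring
begin

text \<open>The hypothesis \<open>f \<otimes> e = f\<close> says that \<open>f\<close> lies below
  \<open>e\<close>; the complement of \<open>f\<close> in the corner of \<open>e\<close> is then an
  idempotent orthogonal to \<open>f\<close>.\<close>

lemma idempotent_compl:
  assumes "e \<in> carrier R" "f \<in> carrier R" "e \<otimes> e = e" "f \<otimes> f = f" "f \<otimes> e = f"
  shows "(e \<ominus> f) \<otimes> (e \<ominus> f) = e \<ominus> f" "(e \<ominus> f) \<otimes> e = e \<ominus> f" "(e \<ominus> f) \<otimes> f = \<zero>"
proof -
  have "e \<otimes> f = f"
    using assms m_comm by metis
  then show "(e \<ominus> f) \<otimes> f = \<zero>" "(e \<ominus> f) \<otimes> e = e \<ominus> f"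
    using assms by (simp_all add: a_minus_def l_distr l_minus r_neg)
  moreover have "(e \<ominus> f) \<otimes> (e \<ominus> f) = (e \<ominus> f) \<otimes> e \<ominus> (e \<ominus> f) \<otimes> f"
    using assms by (simp add: a_minus_def r_distr r_minus)
  ultimately show "(e \<ominus> f) \<otimes> (e \<ominus> f) = e \<ominus> f"
    using assms by (simp add: a_minus_def[of R _ \<zero>])
qed

text \<open>For an idempotent \<open>e\<close>, the fixed points of multiplication by
  \<open>e\<close> form exactly the ideal eR, which is a ring with identity \<open>e\<close>. The
  partner \<open>y\<close> in \<open>inv\<close> may lie outside this ideal.\<close>

lemma field_corner:
  assumes e: "e \<in> carrier R" "e \<otimes> e = e" "e \<noteq> \<zero>"
    and inv: "\<And>x. \<lbrakk>x \<in> carrier R; e \<otimes> x = x; x \<noteq> \<zero>\<rbrakk> \<Longrightarrow> \<exists>y\<in>carrier R. x \<otimes> y = e"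
  shows "field (R\<lparr>carrier := {x \<in> carrier R. e \<otimes> x = x}, one := e\<rparr>)" (is "field ?F")
proof -
  have closed: "e \<otimes> (x \<otimes> y) = x \<otimes> y" if "x \<in> carrier R" "y \<in> carrier R" "e \<otimes> x = x" for x y
    using that e by (metis m_assoc)
  have "\<exists>y\<in>carrier ?F. y \<oplus>\<^bsub>?F\<^esub> x = \<zero>\<^bsub>?F\<^esub>" if "x \<in> carrier ?F" for x
    using that e by (intro bexI[of _ "\<ominus> x"]) (auto simp: r_minus l_neg)
  then have "abelian_group ?F"
    by (intro abelian_groupI) (auto simp: e r_distr a_ac)
  moreover have "comm_monoid ?F"
    by (rule comm_monoidI) (auto simp: e m_assoc closed intro: m_comm)
  ultimately have F: "cring ?F"
    by (rule cringI) (simp add: l_distr)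
  show ?thesis
  proof (rule cring.cring_fieldI2[OF F])
    show "\<zero>\<^bsub>?F\<^esub> \<noteq> \<one>\<^bsub>?F\<^esub>"
      using e by simp
  next
    fix x assume "x \<in> carrier ?F" "x \<noteq> \<zero>\<^bsub>?F\<^esub>"
    then have x: "x \<in> carrier R" "e \<otimes> x = x" "x \<noteq> \<zero>"
      by auto
    then obtain y where y: "y \<in> carrier R" "x \<otimes> y = e"
      using inv by blast
    \<comment> \<open>Multiplying \<open>y\<close> by \<open>e\<close> moves it into the corner; the
      product with \<open>x\<close> is unchanged because \<open>x\<close> absorbs
      \<open>e\<close>.\<close>
    have "x \<otimes> (e \<otimes> y) = e"
      using x y e by (metis m_assoc m_comm)
    moreover have "e \<otimes> y \<in> carrier ?F"
      using y e by (simp add: closed)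
    ultimately show "\<exists>b\<in>carrier ?F. x \<otimes>\<^bsub>?F\<^esub> b = \<one>\<^bsub>?F\<^esub>"
      by auto
  qed
qed

text \<open>This is the Peirce decomposition R = gR + eR, where gR = {0, g} is a copy of the field
  with two elements.\<close>

lemma iso_F2_times_corner:
  assumes e: "e \<in> carrier R" "e \<otimes> e = e" and g: "g \<in> carrier R" "e \<oplus> g = \<one>" "g \<noteq> \<zero>"
    and two: "\<And>x. x \<in> carrier R \<Longrightarrow> g \<otimes> x \<in> {\<zero>, g}"
  shows "R \<simeq> RDirProd (residue_ring 2) (R\<lparr>carrier := {x \<in> carrier R. e \<otimes> x = x}, one := e\<rparr>)"
    (is "R \<simeq> RDirProd _ ?F")
proof -
  \<comment> \<open>Expanding e(e + g) = e gives eg = 0; then (e + g)g = g gives gg = g. So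
    \<open>e\<close> and \<open>g\<close> are complementary orthogonal idempotents.\<close>
  have "e \<oplus> e \<otimes> g = e \<oplus> \<zero>"
    using e g r_distr[of e g e] r_one[of e] by simp
  then have eg: "e \<otimes> g = \<zero>"
    using e g by (metis add.l_cancel m_closed zero_closed)
  then have ge: "g \<otimes> e = \<zero>"
    using e g by (metis m_comm)
  have gg: "g \<otimes> g = g"
    using e g eg l_distr[of e g g] by simp
  \<comment> \<open>The alternative g + g = g would force g = 0, so addition in gR is addition
    modulo 2.\<close>
  have "g \<oplus> g \<in> {\<zero>, g}"
    using two[of "g \<oplus> g"] g by (simp add: r_distr gg)
  then have g2: "g \<oplus> g = \<zero>"
    using g by (metis add.r_cancel_one' empty_iff insert_iff)
  \<comment> \<open>\<open>k\<close> reads the component gx, which is either 0 or \<open>g\<close>,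
    as a bit.\<close>
  define k where "k x = (if g \<otimes> x = \<zero> then 0 else 1 :: int)" for x
  define h where "h x = (k x, e \<otimes> x)" for x
  have split: "x = g \<otimes> x \<oplus> e \<otimes> x" if "x \<in> carrier R" for x
    using that e g by (metis l_distr l_one a_comm)
  have k_add: "k (x \<oplus> y) = (k x + k y) mod 2" if "x \<in> carrier R" "y \<in> carrier R" for x y
    using two[OF that(1)] two[OF that(2)] that g by (auto simp: k_def r_distr g2)
  have k_mult: "k (x \<otimes> y) = (k x * k y) mod 2" if "x \<in> carrier R" "y \<in> carrier R" for x y
  proof -
    have "g \<otimes> (x \<otimes> y) = (g \<otimes> x) \<otimes> (g \<otimes> y)"
      using that g gg by (metis m_assoc m_comm m_closed)
    then show ?thesis
      using two[OF that(1)] two[OF that(2)] that g by (auto simp: k_def gg)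
  qed
  have "h \<in> ring_iso R (RDirProd (residue_ring 2) ?F)"
  proof (rule ring_iso_memI)
    fix x assume x: "x \<in> carrier R"
    then show "h x \<in> carrier (RDirProd (residue_ring 2) ?F)"
      using e by (auto simp: RDirProd_carrier h_def k_def residue_ring_def simp flip: m_assoc)
  next
    fix x y assume xy: "x \<in> carrier R" "y \<in> carrier R"
    have "e \<otimes> (x \<otimes> y) = (e \<otimes> x) \<otimes> (e \<otimes> y)"
      using xy e by (metis m_assoc m_comm m_closed)
    then show "h (x \<otimes> y) = h x \<otimes>\<^bsub>RDirProd (residue_ring 2) ?F\<^esub> h y"
      using xy k_mult
      by (simp add: h_def RDirProd_def DirProd_def monoid.defs residue_ring_def)
    show "h (x \<oplus> y) = h x \<oplus>\<^bsub>RDirProd (residue_ring 2) ?F\<^esub> h y"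
      using xy k_add e
      by (simp add: h_def RDirProd_def DirProd_def monoid.defs residue_ring_def r_distr)
  next
    show "h \<one> = \<one>\<^bsub>RDirProd (residue_ring 2) ?F\<^esub>"
      using e g by (simp add: h_def k_def RDirProd_def DirProd_def monoid.defs residue_ring_def)
  next
    have "x = y" if "x \<in> carrier R" "y \<in> carrier R" "h x = h y" for x y
    proof -
      have "g \<otimes> x = g \<otimes> y"
        using that two[of x] two[of y] g by (auto simp: h_def k_def split: if_splits)
      then show ?thesis
        using that split[of x] split[of y] by (simp add: h_def)
    qed
    then have "inj_on h (carrier R)"
      by (auto simp: inj_on_def)
    moreover have "(i, x) \<in> h ` carrier R" if "i \<in> {0..1}" "x \<in> carrier R" "e \<otimes> x = x" for i x
    proof -
      have "g \<otimes> x = (g \<otimes> e) \<otimes> x"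
        using that e g by (metis m_assoc)
      then have "g \<otimes> x = \<zero>"
        using that ge by simp
      \<comment> \<open>For \<open>x\<close> in the corner, the bit is switched on by adding
        \<open>g\<close>, which leaves the other component alone because eg = 0.\<close>
      then have "h x = (0, x)" "h (g \<oplus> x) = (1, x)"
        using that e g by (simp_all add: h_def k_def r_distr gg eg)
      moreover have "i = 0 \<or> i = 1"
        using that by auto
      ultimately show ?thesis
        using that g by (metis image_eqI a_closed)
    qed
    ultimately show "bij_betw h (carrier R) (carrier (RDirProd (residue_ring 2) ?F))"
      using e
      by (auto simp: bij_betw_def RDirProd_carrier residue_ring_def)
        (auto simp: h_def k_def simp flip: m_assoc)
  qed
  then show ?thesis
    by (auto simp: is_ring_iso_def)
qed

section \<open>Structure forced on a regular ring by a pendant vertex\<close>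

lemma regular_generalised_inverse:
  assumes "von_neumann_regular_ring R" "x \<in> carrier R"
  obtains y where "y \<in> carrier R" "x \<otimes> y \<otimes> x = x" "y \<otimes> x \<otimes> y = y"
proof -
  interpret von_neumann_regular_ring R by fact
  obtain z where z: "z \<in> carrier R" "x \<otimes> z \<otimes> x = x"
    using von_neumann_regular assms by blast
  \<comment> \<open>A regularity witness \<open>z\<close> need not satisfy zxz = z; replacing it by
    zxz secures both identities.\<close>
  let ?y = "z \<otimes> x \<otimes> z"
  have "x \<otimes> ?y \<otimes> x = (x \<otimes> z \<otimes> x) \<otimes> z \<otimes> x"
    using z(1) assms(2) by (simp add: m_assoc)
  then have 1: "x \<otimes> ?y \<otimes> x = x"
    using z by simp
  have "?y \<otimes> x \<otimes> ?y = z \<otimes> (x \<otimes> ?y \<otimes> x) \<otimes> z"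
    using z(1) assms(2) by (simp add: m_assoc)
  then have "?y \<otimes> x \<otimes> ?y = ?y"
    using 1 by simp
  with 1 show thesis
    using z(1) assms(2) by (intro that[of ?y]) simp_all
qed

lemma pendant_neighbours_eq:
  assumes "pendant_vertex (with_proj (reg_graph R)) a"
    and "b \<in> carrier R - {\<zero>, a}" "a \<otimes> b \<otimes> a = a \<or> b \<otimes> a \<otimes> b = b"
    and "c \<in> carrier R - {\<zero>, a}" "a \<otimes> c \<otimes> a = a \<or> c \<otimes> a \<otimes> c = c"
  shows "b = c"
proof -
  have "a \<in> carrier R - {\<zero>}"
    using assms(1) by (simp add: pendant_vertex_reg_graph_iff)
  then have "(a, b) \<in> parcs (reg_graph R)" "(a, c) \<in> parcs (reg_graph R)"
    using assms(2-) by (auto simp: reg_graph_def)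
  then show ?thesis
    using assms(1) by (auto simp: pendant_vertex_reg_graph_iff)
qed

text \<open>For each nontrivial idempotent \<open>p\<close> below e = aa', the element pa' is a
  neighbour of \<open>a\<close>, and \<open>p\<close> is recovered from it as pa'a. Were
  \<open>f\<close> nontrivial, \<open>f\<close> and e - f would thus yield two different
  neighbours.\<close>

lemma pendant_idempotent_primitive:
  assumes pend: "pendant_vertex (with_proj (reg_graph R)) a"
    and a: "a \<in> carrier R" "a' \<in> carrier R" "a \<otimes> a' \<otimes> a = a" "a' \<otimes> a \<otimes> a' = a'"
    and f: "f \<in> carrier R" "f \<otimes> f = f" "f \<otimes> (a \<otimes> a') = f"
  shows "f = \<zero> \<or> f = a \<otimes> a'"
proof (rule ccontr)
  assume contra: "\<not> ?thesis"
  define e where "e = a \<otimes> a'"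
  have e: "e \<in> carrier R" "e \<otimes> e = e" "a \<otimes> e = a" "a' \<otimes> e = a'" "e \<otimes> a = a"
    using a by (simp_all add: e_def m_ac)
  have nbr: "p \<otimes> a' \<in> carrier R - {\<zero>, a}"
       "p \<otimes> a' \<otimes> a \<otimes> (p \<otimes> a') = p \<otimes> a'" "p \<otimes> a' \<otimes> a = p"
    if p: "p \<in> carrier R" "p \<otimes> p = p" "p \<otimes> e = p" "p \<noteq> \<zero>" "p \<noteq> e" for p
  proof -
    show pa: "p \<otimes> a' \<otimes> a = p"
      using p(1,3) a by (simp add: e_def m_ac)
    show "p \<otimes> a' \<otimes> a \<otimes> (p \<otimes> a') = p \<otimes> a'"
      unfolding pa using p(1,2) a by (simp flip: m_assoc)
    \<comment> \<open>If pa' = a, then pa = a by idempotence of \<open>p\<close>, hence pe = e; but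
      pe = p, contradicting the choice of \<open>p\<close>.\<close>
    have "p \<otimes> a' \<noteq> a"
    proof
      assume *: "p \<otimes> a' = a"
      have "p \<otimes> a = p \<otimes> (p \<otimes> a')"
        by (simp only: *)
      also have "\<dots> = a"
        using p(1,2) a(2) * by (metis m_assoc)
      finally have "p \<otimes> a \<otimes> a' = e"
        by (simp add: e_def)
      then show False
        using p a by (simp add: m_assoc e_def)
    qed
    moreover have "p \<otimes> a' \<noteq> \<zero>"
      using pa p(4) a by auto
    ultimately show "p \<otimes> a' \<in> carrier R - {\<zero>, a}"
      using p a by simp
  qed
  have fe: "f \<otimes> e = f" "f \<noteq> \<zero>" "f \<noteq> e"
    using f contra by (auto simp: e_def)
  define q where "q = e \<ominus> f"
  have q: "q \<in> carrier R" "q \<otimes> q = q" "q \<otimes> e = q" "q \<otimes> f = \<zero>"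
    using idempotent_compl[OF e(1) f(1) e(2) f(2) fe(1)] e f by (auto simp: q_def)
  have "q \<noteq> \<zero>"
    using e f fe by (simp add: q_def)
  moreover have "q \<noteq> e"
    using q(4) f e fe by (metis m_comm)
  ultimately have "f \<otimes> a' = q \<otimes> a'"
    using pendant_neighbours_eq[OF pend] nbr q f fe by metis
  then have "f = q"
    using nbr(3)[OF f(1,2) fe] nbr(3)[OF q(1,2,3) \<open>q \<noteq> \<zero>\<close> \<open>q \<noteq> e\<close>] by metis
  then show False
    using q f fe by simp
qed

text \<open>Adding an annihilator of \<open>a\<close> to \<open>a'\<close> preserves aa'a = a. If 0,
  \<open>u\<close>, \<open>v\<close> were distinct, their three translates by \<open>a'\<close>
  would be distinct with at most one equal to \<open>a\<close>, leaving two neighbours.\<close>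

lemma pendant_annihilator_small:
  assumes pend: "pendant_vertex (with_proj (reg_graph R)) a"
    and a: "a \<in> carrier R" "a \<noteq> \<zero>" "a' \<in> carrier R" "a \<otimes> a' \<otimes> a = a"
    and uv: "u \<in> carrier R" "a \<otimes> u = \<zero>" "v \<in> carrier R" "a \<otimes> v = \<zero>" "u \<noteq> \<zero>"
  shows "v \<in> {\<zero>, u}"
proof (rule ccontr)
  assume v: "v \<notin> {\<zero>, u}"
  have nbr: "a \<otimes> (a' \<oplus> t) \<otimes> a = a" "a' \<oplus> t \<in> carrier R" "a' \<oplus> t \<noteq> \<zero>"
    if t: "t \<in> carrier R" "a \<otimes> t = \<zero>" for t
  proof -
    show "a \<otimes> (a' \<oplus> t) \<otimes> a = a" "a' \<oplus> t \<in> carrier R"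
      using t a by (simp_all add: r_distr)
    then show "a' \<oplus> t \<noteq> \<zero>"
      using a by auto
  qed
  have eq: "s = t" if "s \<in> {\<zero>, u, v}" "t \<in> {\<zero>, u, v}" "a' \<oplus> s \<noteq> a" "a' \<oplus> t \<noteq> a" for s t
  proof -
    have s: "s \<in> carrier R" "a \<otimes> s = \<zero>" and t: "t \<in> carrier R" "a \<otimes> t = \<zero>"
      using that uv a by auto
    have "a' \<oplus> s = a' \<oplus> t"
      by (rule pendant_neighbours_eq[OF pend]) (use nbr[OF s] nbr[OF t] that in auto)
    then show ?thesis
      using s t a by simp
  qed
  have "a' \<oplus> s \<noteq> a \<or> a' \<oplus> t \<noteq> a" if "s \<noteq> t" "s \<in> {\<zero>, u, v}" "t \<in> {\<zero>, u, v}" for s t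
    using that a uv by (metis add.l_cancel empty_iff insert_iff zero_closed)
  then show False
    using eq v uv(5) by (metis insert_iff)
qed

lemma pendant_vertex_imp_field_or_product:
  assumes reg: "von_neumann_regular_ring R"
    and pend: "pendant_vertex (with_proj (reg_graph R)) a"
  shows "field R \<or> (\<exists>F :: 'a ring. field F \<and> R \<simeq> RDirProd (residue_ring 2) F)"
proof -
  have a: "a \<in> carrier R" "a \<noteq> \<zero>"
    using pend by (auto simp: pendant_vertex_reg_graph_iff)
  obtain a' where a': "a' \<in> carrier R" "a \<otimes> a' \<otimes> a = a" "a' \<otimes> a \<otimes> a' = a'"
    using regular_generalised_inverse[OF reg a(1)] .
  define e where "e = a \<otimes> a'"
  have e: "e \<in> carrier R" "e \<otimes> e = e" "e \<otimes> a = a"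
    using a a' by (simp_all add: e_def m_ac)
  then have "e \<noteq> \<zero>"
    using a by auto
  \<comment> \<open>For a regularity witness \<open>y\<close> of \<open>x\<close>, the product xy is
    an idempotent below \<open>e\<close>. It is nonzero because xyx = x, so primitivity makes it
    \<open>e\<close>.\<close>
  have inv: "\<exists>y\<in>carrier R. x \<otimes> y = e" if x: "x \<in> carrier R" "e \<otimes> x = x" "x \<noteq> \<zero>" for x
  proof -
    obtain y where y: "y \<in> carrier R" "x \<otimes> y \<otimes> x = x"
      using regular_generalised_inverse[OF reg x(1)] by blast
    have f: "x \<otimes> y \<in> carrier R" "(x \<otimes> y) \<otimes> (x \<otimes> y) = x \<otimes> y"
      using x y by (simp_all flip: m_assoc)
    have "x \<otimes> y \<otimes> e = (e \<otimes> x) \<otimes> y"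
      using x y e(1) by (metis m_assoc m_comm m_closed)
    then have "x \<otimes> y \<otimes> (a \<otimes> a') = x \<otimes> y"
      using x by (simp add: e_def)
    then have "x \<otimes> y = \<zero> \<or> x \<otimes> y = e"
      using pendant_idempotent_primitive[OF pend a(1) a' f] by (simp add: e_def)
    then show ?thesis
      using x y by auto
  qed
  show ?thesis
  proof (cases "e = \<one>")
    case True
    then have "field R"
      using \<open>e \<noteq> \<zero>\<close> inv by (intro cring_fieldI2) auto
    then show ?thesis ..
  next
    case False
    let ?F = "R\<lparr>carrier := {x \<in> carrier R. e \<otimes> x = x}, one := e\<rparr>"
    define g where "g = \<one> \<ominus> e"
    have "g \<noteq> \<zero>"
      using False e by (simp add: g_def)
    moreover have g: "g \<in> carrier R" "e \<oplus> g = \<one>"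
      using e a_lcomm[of e \<one> "\<ominus> e"] by (simp_all add: g_def a_minus_def r_neg)
    \<comment> \<open>Since ea = a, all of gR annihilates \<open>a\<close>; comparing its elements
      with the nonzero annihilator \<open>g\<close> gives gR = {0, g}.\<close>
    moreover have "g \<otimes> a = \<zero>"
      using e a by (simp add: g_def a_minus_def l_distr l_minus r_neg)
    then have "a \<otimes> (g \<otimes> x) = \<zero>" if "x \<in> carrier R" for x
      using a g that by (metis m_assoc m_comm l_null)
    then have "g \<otimes> x \<in> {\<zero>, g}" if "x \<in> carrier R" for x
      using pendant_annihilator_small[OF pend a a'(1,2), of g "g \<otimes> x"] \<open>g \<noteq> \<zero>\<close> g that
      by (metis m_closed one_closed r_one)
    ultimately have "R \<simeq> RDirProd (residue_ring 2) ?F"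
      using iso_F2_times_corner e by blast
    moreover have F: "field ?F"
      using field_corner[OF e(1,2) \<open>e \<noteq> \<zero>\<close> inv] .
    moreover have "ring (residue_ring 2)"
      using residues.cring[of 2] by (simp add: residues_def cring.axioms)
    \<comment> \<open>The corner inherits the record extension of \<open>R\<close>, so it is
      exchanged for an isomorphic field of type \<open>'a ring\<close>.\<close>
    ultimately show ?thesis
      using iso_RDirProd_field_same_type[OF ring_axioms] by blast
  qed
qed

end

section \<open>Pendant vertices in fields and in products with the two-element field\<close>

lemma (in field) regular_edge_iff:
  assumes "a \<in> carrier R - {\<zero>}" "b \<in> carrier R"
  shows "a \<otimes> b \<otimes> a = a \<longleftrightarrow> a \<otimes> b = \<one>"
proof -
  have "a \<otimes> b \<otimes> a = \<one> \<otimes> a \<longleftrightarrow> a \<otimes> b = \<one>"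
    using assms by (intro m_rcancel) simp_all
  then show ?thesis
    using assms by simp
qed

text \<open>Cancelling a nonzero factor reduces both alternatives of adjacency to the same equation
  ab = 1.\<close>

lemma (in field) parcs_reg_graph_field:
  "(a, b) \<in> parcs (reg_graph R) \<longleftrightarrow>
    a \<in> carrier R - {\<zero>} \<and> b \<in> carrier R - {\<zero>} \<and> a \<noteq> b \<and> a \<otimes> b = \<one>"
proof (cases "a \<in> carrier R - {\<zero>} \<and> b \<in> carrier R - {\<zero>}")
  case True
  then have "b \<otimes> a = a \<otimes> b"
    by (simp add: m_comm)
  with True show ?thesis
    using regular_edge_iff[of a b] regular_edge_iff[of b a]
    by (simp add: reg_graph_def)
qed (auto simp: reg_graph_def)

text \<open>An edge joins two distinct mutually inverse elements; neither is 1, so together with 0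
  and 1 they make four. Conversely, a fourth element provides some \<open>a\<close> outside {0, 1,
  -1}. As the only square roots of 1 are 1 and -1, \<open>a\<close> differs from its inverse, which
  is its unique neighbour.\<close>

lemma (in field) ex_pendant_vertex_iff:
  assumes fin: "finite (carrier R)"
  shows "(\<exists>v. pendant_vertex (with_proj (reg_graph R)) v) \<longleftrightarrow> card (carrier R) \<ge> 4"
proof
  assume "\<exists>v. pendant_vertex (with_proj (reg_graph R)) v"
  then obtain a b where ab: "a \<in> carrier R" "b \<in> carrier R" "a \<noteq> \<zero>" "b \<noteq> \<zero>"
    "a \<noteq> b" "a \<otimes> b = \<one>"
    by (auto simp: pendant_vertex_reg_graph_iff parcs_reg_graph_field)
  moreover from this have "a \<noteq> \<one>" "b \<noteq> \<one>"
    by auto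
  ultimately have "card {a, b, \<zero>, \<one>} = 4"
    by (simp add: card_insert_if)
  moreover have "card {a, b, \<zero>, \<one>} \<le> card (carrier R)"
    using ab fin by (intro card_mono) auto
  ultimately show "card (carrier R) \<ge> 4"
    by simp
next
  assume "card (carrier R) \<ge> 4"
  moreover have "card {\<zero>, \<one>, \<ominus> \<one>} \<le> 3"
    by (simp add: card_insert_if)
  ultimately have "\<not> carrier R \<subseteq> {\<zero>, \<one>, \<ominus> \<one>}"
    using card_mono[of "{\<zero>, \<one>, \<ominus> \<one>}" "carrier R"] by force
  then obtain a where a: "a \<in> carrier R" "a \<noteq> \<zero>" "a \<noteq> \<one>" "a \<noteq> \<ominus> \<one>"
    by auto
  then have u: "a \<in> Units R"
    by (simp add: field_Units)
  have "a \<noteq> inv a"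
  proof
    assume "a = inv a"
    then have "a \<otimes> a = \<one>"
      using Units_r_inv[OF u] by simp
    then show False
      using square_eq_one a by blast
  qed
  moreover have "inv a \<in> carrier R" "a \<otimes> inv a = \<one>"
    using u by auto
  moreover from this have "inv a \<noteq> \<zero>"
    using a by auto
  ultimately have "(a, inv a) \<in> parcs (reg_graph R)"
    using a by (simp add: parcs_reg_graph_field)
  moreover have "b = inv a" if "(a, b) \<in> parcs (reg_graph R)" for b
    using that a comm_inv_char[of a b] by (simp add: parcs_reg_graph_field)
  ultimately show "\<exists>v. pendant_vertex (with_proj (reg_graph R)) v"
    using a by (auto simp: pendant_vertex_reg_graph_iff)
qed

lemma (in field) pendant_vertex_F2_times_field:
  "pendant_vertex (with_proj (reg_graph (RDirProd (residue_ring 2) R))) (0, \<one>)"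
proof -
  let ?P = "RDirProd (residue_ring 2) R"
  have P: "carrier ?P = {0..1} \<times> carrier R" "\<zero>\<^bsub>?P\<^esub> = (0, \<zero>)"
    "(i, x) \<otimes>\<^bsub>?P\<^esub> (j, y) = (i * j mod 2, x \<otimes> y)" for i j x y
    by (simp_all add: RDirProd_def DirProd_def monoid.defs residue_ring_def)
  have "((0, \<one>), (1, \<one>)) \<in> parcs (reg_graph ?P)"
    by (simp add: reg_graph_def P)
  moreover have "b = (1, \<one>)" if b: "((0, \<one>), b) \<in> parcs (reg_graph ?P)" for b
  proof -
    obtain i x where ix: "b = (i, x)"
      by (cases b)
    have i: "i = 0 \<or> i = 1" and x: "x \<in> carrier R"
      using b by (auto simp: reg_graph_def P ix)
    \<comment> \<open>The first alternative of adjacency reads (0, x) = (0, 1), the second (0, xx) =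
      (i, x). Idempotents of a field being 0 and 1, the second only returns the zero element or the
      vertex itself.\<close>
    have "x = \<one> \<or> i = 0 \<and> x \<otimes> x = x" "(i, x) \<noteq> (0, \<zero>)" "(i, x) \<noteq> (0, \<one>)"
      using b i x by (auto simp: reg_graph_def P ix)
    moreover have "x = \<zero> \<or> x = \<one>" if "x \<otimes> x = x"
      using that x m_rcancel[of x x \<one>] by auto
    ultimately show ?thesis
      using i ix by auto
  qed
  ultimately show ?thesis
    by (auto simp: pendant_vertex_reg_graph_iff P)
qed

theorem theorem6:
  fixes R :: "('a, 'm) ring_scheme"
  assumes "cring R" and "von_neumann_regular_ring R" and "finite (carrier R)"
  shows "(\<exists>v. pendant_vertex (with_proj (reg_graph R)) v) \<longleftrightarrow>
    (\<exists>F\<^sub>1 :: 'a ring. field F\<^sub>1 \<and> card (carrier F\<^sub>1) \<ge> 4 \<and> R \<simeq> F\<^sub>1) \<or>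
    (\<exists>F :: 'a ring. field F \<and> R \<simeq> RDirProd (residue_ring 2) F)"
proof -
  interpret cring R by fact
  have K: "ring (residue_ring 2)"
    using residues.cring[of 2] by (simp add: residues_def cring.axioms)
  show ?thesis
  proof (intro iffI; (elim disjE exE conjE)?)
    fix v assume v: "pendant_vertex (with_proj (reg_graph R)) v"
    \<comment> \<open>When \<open>R\<close> is itself a field, the reflexive isomorphism supplies a
      copy of it of type \<open>'a ring\<close> with the same cardinality.\<close>
    show "(\<exists>F\<^sub>1 :: 'a ring. field F\<^sub>1 \<and> card (carrier F\<^sub>1) \<ge> 4 \<and> R \<simeq> F\<^sub>1) \<or>
      (\<exists>F :: 'a ring. field F \<and> R \<simeq> RDirProd (residue_ring 2) F)"
      using pendant_vertex_imp_field_or_product[OF assms(2) v]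
        field.ex_pendant_vertex_iff[OF _ assms(3)] v
        iso_field_same_type[OF ring_axioms _ ring_iso_refl] by metis
  next
    fix F :: "'a ring" assume F: "field F" "card (carrier F) \<ge> 4" "R \<simeq> F"
    \<comment> \<open>Infinite sets have \<open>card\<close> equal to 0, so the bound of 4 already
      implies finiteness.\<close>
    then have "finite (carrier F)"
      by (simp add: card_ge_0_finite)
    then show "\<exists>v. pendant_vertex (with_proj (reg_graph R)) v"
      using F field.ex_pendant_vertex_iff[OF F(1)] ring_iso_pendant_vertex
        ring_iso_sym[OF ring_axioms F(3)] ring_axioms field.is_ring[OF F(1)] by metis
  next
    fix F :: "'a ring" assume F: "field F" "R \<simeq> RDirProd (residue_ring 2) F"
    have "ring (RDirProd (residue_ring 2) F)"
      using RDirProd_ring[OF K field.is_ring[OF F(1)]] .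
    then show "\<exists>v. pendant_vertex (with_proj (reg_graph R)) v"
      using ring_iso_pendant_vertex[OF _ ring_axioms ring_iso_sym[OF ring_axioms F(2)]]
        field.pendant_vertex_F2_times_field[OF F(1)] by blast
  qed
qed

end
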